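(* For every even integer $n\ge 4$, the cycle $C_n$ on $n$ vertices is critically $1$-uniform.
   Context: $[k]=\{1,\dots,k\}$ and $\chi(G)$ is the chromatic number of a graph $G=(V,E)$. For a proper coloring $c:V\to[\chi(G)]$, a determining set for $(G,c)$ is a set $S\subseteq V$ such that for every proper coloring $c':V\to[\chi(G)]$ of $G$, if $c'|_S=c|_S$ then $c'=c$ on all of $V$. A critical set for $(G,c)$ is a determining set for $(G,c)$ that is minimal under inclusion. $G$ is critically $k$-uniform if for every proper coloring $c:V\to[\chi(G)]$, every critical set $S$ for $(G,c)$ satisfies $|S|=k$. *)

theory Defs
  imports "Graph_Theory.Graph_Theory"
begin

(* A finite simple graph is a pair_graph: a finite loop-free pair digraph with symmetric
   arc relation, so that each undirected edge {u, v} appears as both arcs (u, v) and (v, u).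
   The definitions below are meant for such graphs. Colourings are total functions of which
   only the values on the vertices matter; hence "c' = c" is stated as agreement there. *)

definition proper_coloring :: "'a pair_pre_digraph \<Rightarrow> nat \<Rightarrow> ('a \<Rightarrow> nat) \<Rightarrow> bool" where
  "proper_coloring G k c \<longleftrightarrow>
     c \<in> pverts G \<rightarrow> {1..k} \<and> (\<forall>(u, v) \<in> parcs G. c u \<noteq> c v)"

definition chromatic_number :: "'a pair_pre_digraph \<Rightarrow> nat" where
  "chromatic_number G = (LEAST k. \<exists>c. proper_coloring G k c)"

definition determining_set :: "'a pair_pre_digraph \<Rightarrow> ('a \<Rightarrow> nat) \<Rightarrow> 'a set \<Rightarrow> bool" where
  "determining_set G c S \<longleftrightarrow>
     S \<subseteq> pverts G \<and>
     (\<forall>c'. proper_coloring G (chromatic_number G) c' \<longrightarrow>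
        (\<forall>v\<in>S. c' v = c v) \<longrightarrow> (\<forall>v\<in>pverts G. c' v = c v))"

definition critical_set :: "'a pair_pre_digraph \<Rightarrow> ('a \<Rightarrow> nat) \<Rightarrow> 'a set \<Rightarrow> bool" where
  "critical_set G c S \<longleftrightarrow>
     determining_set G c S \<and> (\<forall>T. T \<subset> S \<longrightarrow> \<not> determining_set G c T)"

definition critically_uniform :: "'a pair_pre_digraph \<Rightarrow> nat \<Rightarrow> bool" where
  "critically_uniform G k \<longleftrightarrow>
     (\<forall>c. proper_coloring G (chromatic_number G) c \<longrightarrow>
        (\<forall>S. critical_set G c S \<longrightarrow> card S = k))"

(* The cycle on the vertices 0, ..., n - 1, meant for n >= 3: for n = 1 there is a
   loop, and for n = 2 a single edge. *)
definition cycle_graph :: "nat \<Rightarrow> nat pair_pre_digraph" where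
  "cycle_graph n =
     \<lparr>pverts = {0..<n},
      parcs = {(u, v). u < n \<and> v < n \<and> (v = (u + 1) mod n \<or> u = (v + 1) mod n)}\<rparr>"

lemma pair_graph_cycle_graph:
  assumes "n \<ge> 3"
  shows "pair_graph (cycle_graph n)"
proof
  show "finite (pverts (cycle_graph n))"
    by (simp add: cycle_graph_def)
  show "finite (parcs (cycle_graph n))"
    by (rule finite_subset[of _ "{..<n} \<times> {..<n}"]) (auto simp: cycle_graph_def)
  show "symmetric (with_proj (cycle_graph n))"
    by (auto simp: symmetric_def arcs_ends_def arc_to_ends_def cycle_graph_def sym_def)
next
  fix e assume e: "e \<in> parcs (cycle_graph n)"
  then show "fst e \<in> pverts (cycle_graph n)" "snd e \<in> pverts (cycle_graph n)"
    by (auto simp: cycle_graph_def)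
  have "Suc u mod n \<noteq> u" if "u < n" for u
    using that assms by (cases "Suc u = n") auto
  then show "fst e \<noteq> snd e"
    using e unfolding cycle_graph_def by (auto dest: sym)
qed

end

theory Submission
  imports Defs
begin

text \<open>An even cycle has chromatic number 2 (\<open>chromatic_number_even_cycle\<close>). With
  two colours, the colour of one end of an edge forces that of the other, so along the connected
  cycle two proper colourings agree everywhere or nowhere
  (\<open>cycle_graph_coloring_agree\<close>). Hence every single vertex is determining. The empty
  set is not, since exchanging the two colours gives a different proper colouring
  (\<open>proper_2_coloring_swap\<close>). A minimal determining set is therefore a
  singleton.\<close>

lemma proper_2_coloring_range:
  assumes "proper_coloring G 2 c" "v \<in> pverts G"
  shows "c v = 1 \<or> c v = 2"
proof -
  have "c v \<in> {1..2}"
    using assms unfolding proper_coloring_def by blast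
  then show ?thesis
    by auto
qed

lemma proper_2_coloring_agree_arc:
  assumes "proper_coloring G 2 c" "proper_coloring G 2 c'"
    and "u \<in> pverts G" "v \<in> pverts G" "(u, v) \<in> parcs G"
  shows "c' u = c u \<longleftrightarrow> c' v = c v"
proof -
  have "c u \<noteq> c v" "c' u \<noteq> c' v"
    using assms unfolding proper_coloring_def by blast+
  then show ?thesis
    using assms proper_2_coloring_range by metis
qed

text \<open>The map x \<mapsto> 3 - x exchanges the colours 1 and 2. The result differs from
  \<open>c\<close> at every vertex, which rules out the empty set as a determining set.\<close>

lemma proper_2_coloring_swap:
  assumes "proper_coloring G 2 c" "fst ` parcs G \<union> snd ` parcs G \<subseteq> pverts G"
  shows "proper_coloring G 2 (\<lambda>v. 3 - c v)"
  unfolding proper_coloring_def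
proof (intro conjI Pi_I ballI)
  fix v assume "v \<in> pverts G"
  then show "3 - c v \<in> {1..2}"
    using proper_2_coloring_range[OF assms(1)] by fastforce
next
  fix a assume a: "a \<in> parcs G"
  obtain u v where uv: "a = (u, v)"
    by (cases a)
  have "u \<in> pverts G" "v \<in> pverts G"
    using a uv assms(2) by force+
  moreover have "c u \<noteq> c v"
    using a uv assms(1) unfolding proper_coloring_def by blast
  ultimately have "3 - c u \<noteq> 3 - c v"
    using proper_2_coloring_range[OF assms(1)] by fastforce
  then show "case a of (u, v) \<Rightarrow> 3 - c u \<noteq> 3 - c v"
    by (simp add: uv)
qed

text \<open>Agreement passes in both directions across each arc of the path 0, 1, ..., n - 1. Vertex
  0 is the common reference through which any two vertices are compared.\<close>

lemma cycle_graph_coloring_agree: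
  assumes "proper_coloring (cycle_graph n) 2 c" "proper_coloring (cycle_graph n) 2 c'" "v < n"
  shows "c' v = c v \<longleftrightarrow> c' 0 = c 0"
  using assms(3)
proof (induction v)
  case (Suc v)
  then have "(v, Suc v) \<in> parcs (cycle_graph n)"
    by (simp add: cycle_graph_def)
  then have "c' v = c v \<longleftrightarrow> c' (Suc v) = c (Suc v)"
    using proper_2_coloring_agree_arc[OF assms(1,2)] Suc.prems by (simp add: cycle_graph_def)
  with Suc show ?case
    by simp
qed simp

lemma chromatic_number_even_cycle:
  assumes "even n" "n \<ge> 2"
  shows "chromatic_number (cycle_graph n) = 2"
  unfolding chromatic_number_def
proof (rule Least_equality)
  \<comment> \<open>Evenness of \<open>n\<close> matters at the closing edge, where n - 1 is odd and
    its successor 0 is even.\<close>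
  have "even (Suc u mod n) \<noteq> even u" if "u < n" for u
    using that assms by (cases "Suc u = n") auto
  then have "even u \<noteq> even v" if "(u, v) \<in> parcs (cycle_graph n)" for u v
    using that by (auto simp: cycle_graph_def)
  then have "(u mod 2) + 1 \<noteq> (v mod 2) + 1" if "(u, v) \<in> parcs (cycle_graph n)" for u v
    using that by (metis add_right_cancel even_iff_mod_2_eq_zero)
  \<comment> \<open>Colouring by parity, shifted by 1 because colours start at 1.\<close>
  then have "proper_coloring (cycle_graph n) 2 (\<lambda>v. v mod 2 + 1)"
    unfolding proper_coloring_def by fastforce
  then show "\<exists>c. proper_coloring (cycle_graph n) 2 c"
    by blast
next
  fix k assume "\<exists>c. proper_coloring (cycle_graph n) k c"
  then obtain c where c: "proper_coloring (cycle_graph n) k c"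
    by blast
  \<comment> \<open>A single edge already needs two colours.\<close>
  have "(0, 1) \<in> parcs (cycle_graph n)"
    using assms by (auto simp: cycle_graph_def)
  then have "c 0 \<noteq> c 1"
    using c unfolding proper_coloring_def by blast
  moreover have "c 0 \<in> {1..k}" "c 1 \<in> {1..k}"
    using c assms by (auto simp: proper_coloring_def cycle_graph_def Pi_iff)
  ultimately show "2 \<le> k"
    by auto
qed

theorem corollary5:
  fixes n :: nat
  assumes "even n" and "n \<ge> 4"
  shows "critically_uniform (cycle_graph n) 1"
proof -
  let ?G = "cycle_graph n"
  have chi: "chromatic_number ?G = 2"
    using assms by (simp add: chromatic_number_even_cycle)
  have verts: "pverts ?G = {0..<n}"
    by (simp add: cycle_graph_def)
  have "card S = 1" if c: "proper_coloring ?G 2 c" and S: "critical_set ?G c S" for c S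
  proof -
    have det: "determining_set ?G c S"
      using S by (simp add: critical_set_def)
    have swap: "proper_coloring ?G 2 (\<lambda>v. 3 - c v)"
      by (rule proper_2_coloring_swap[OF c]) (use assms in \<open>auto simp: cycle_graph_def\<close>)
    have "S \<noteq> {}"
    proof
      assume "S = {}"
      then have "\<forall>v\<in>pverts ?G. 3 - c v = c v"
        using det swap unfolding determining_set_def chi by blast
      \<comment> \<open>No natural number satisfies this, even with truncated subtraction.\<close>
      then have "3 - c 0 = c 0"
        using assms verts by simp
      then show False
        by presburger
    qed
    then obtain v where v: "v \<in> S"
      by blast
    have "v < n"
      using v det verts by (auto simp: determining_set_def)
    have "determining_set ?G c {v}"
      unfolding determining_set_def chi
    proof (intro conjI allI impI ballI)
      fix c' w
      assume "proper_coloring ?G 2 c'" "\<forall>u\<in>{v}. c' u = c u" "w \<in> pverts ?G"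
      moreover from this have "c' v = c v" "w < n"
        by (simp_all only: verts atLeastLessThan_iff insertI1)
      ultimately show "c' w = c w"
        using cycle_graph_coloring_agree[OF c] \<open>v < n\<close> by blast
    qed (simp add: verts \<open>v < n\<close>)
    \<comment> \<open>Minimality of \<open>S\<close> leaves no room for a determining singleton
      strictly inside it.\<close>
    moreover have "\<not> {v} \<subset> S" if "determining_set ?G c {v}"
      using S that unfolding critical_set_def by blast
    ultimately have "S = {v}"
      using v by blast
    then show ?thesis
      by simp
  qed
  then show ?thesis
    by (simp add: critically_uniform_def chi)
qed

end
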